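(* Let $X$ be a finite indecomposable q-cycle set and let $p:X\to Y$ be an epimorphism (surjective homomorphism) from $X$ to a q-cycle set $Y$. Then there exist a set $S$ and a dynamical pair $(\alpha,\alpha')$ (for $Y$ and $S$) such that $X\cong Y\times_{\alpha,\alpha'}S$ as q-cycle sets.
   Context: A q-cycle set is a non-empty set $X$ with two binary operations $\cdot$ and $:$ such that for every $x\in X$ the map $\sigma_x:X\to X$, $y\mapsto x\cdot y$ is bijective, and for all $x,y,z\in X$: $(x\cdot y)\cdot(x\cdot z)=(y:x)\cdot(y\cdot z)$, $(x:y):(x:z)=(y\cdot x):(y:z)$, and $(x\cdot y):(x\cdot z)=(y:x)\cdot(y:z)$. It is regular if $\delta_x:X\to X$, $y\mapsto x:y$ is bijective for every $x\in X$. For a regular q-cycle set, $\mathcal{G}(X)=\langle\sigma_x,\delta_x\mid x\in X\rangle\le\mathrm{Sym}_X$, and $X$ is indecomposable if $X$ is regular and $\mathcal{G}(X)$ acts transitively on $X$. All q-cycle sets are finite. Homomorphisms preserve both operations. Given a q-cycle set $Y$, a set $S$, and maps $\alpha:Y\times Y\times S\to\mathrm{Sym}_S$, $\alpha':Y\times Y\times S\to S^S$ (with $S^S$ the set of all maps $S\to S$), write $\alpha_{(x,y)}(s,t)$ for the value at $t$ of $\alpha(x,y,s)$, and similarly $\alpha'_{(x,y)}(s,t)$. The pair $(\alpha,\alpha')$ is a dynamical pair if for all $x,y,z\in Y$ and $s,t,u\in S$: $$\alpha_{(x\cdot y,\,x\cdot z)}(\alpha_{(x,y)}(s,t),\alpha_{(x,z)}(s,u))=\alpha_{(y:x,\,y\cdot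 z)}(\alpha'_{(y,x)}(t,s),\alpha_{(y,z)}(t,u)),$$ $$\alpha'_{(x:y,\,x:z)}(\alpha'_{(x,y)}(s,t),\alpha'_{(x,z)}(s,u))=\alpha'_{(y\cdot x,\,y:z)}(\alpha_{(y,x)}(t,s),\alpha'_{(y,z)}(t,u)),$$ $$\alpha'_{(x\cdot y,\,x\cdot z)}(\alpha_{(x,y)}(s,t),\alpha_{(x,z)}(s,u))=\alpha_{(y:x,\,y:z)}(\alpha'_{(y,x)}(t,s),\alpha'_{(y,z)}(t,u)).$$ Then $Y\times_{\alpha,\alpha'}S$ denotes the q-cycle set on $Y\times S$ with operations $(x,s)\cdot(y,t):=(x\cdot y,\alpha_{(x,y)}(s,t))$ and $(x,s):(y,t):=(x:y,\alpha'_{(x,y)}(s,t))$, called a dynamical extension of $Y$ by $S$. *)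

theory Defs
  imports "HOL-Algebra.Generated_Groups" "HOL-Algebra.Group_Action"
begin

text \<open>The operation written with a colon in the literature is written \<open>\<odot>\<close> here, because the colon
  is reserved for set membership.\<close>

record 'a q_cycle = "'a partial_object" +
  qdot :: "'a \<Rightarrow> 'a \<Rightarrow> 'a" (infixl "\<cdot>\<index>" 70)
  qcolon :: "'a \<Rightarrow> 'a \<Rightarrow> 'a" (infixl "\<odot>\<index>" 70)

locale q_cycle_set =
  fixes X (structure)
  assumes nonempty: "carrier X \<noteq> {}"
    and dot_bij: "x \<in> carrier X \<Longrightarrow> bij_betw (\<lambda>y. x \<cdot> y) (carrier X) (carrier X)"
    and colon_closed: "\<lbrakk>x \<in> carrier X; y \<in> carrier X\<rbrakk> \<Longrightarrow> x \<odot> y \<in> carrier X"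
    and q1: "\<lbrakk>x \<in> carrier X; y \<in> carrier X; z \<in> carrier X\<rbrakk>
      \<Longrightarrow> (x \<cdot> y) \<cdot> (x \<cdot> z) = (y \<odot> x) \<cdot> (y \<cdot> z)"
    and q2: "\<lbrakk>x \<in> carrier X; y \<in> carrier X; z \<in> carrier X\<rbrakk>
      \<Longrightarrow> (x \<odot> y) \<odot> (x \<odot> z) = (y \<cdot> x) \<odot> (y \<odot> z)"
    and q3: "\<lbrakk>x \<in> carrier X; y \<in> carrier X; z \<in> carrier X\<rbrakk>
      \<Longrightarrow> (x \<cdot> y) \<odot> (x \<cdot> z) = (y \<odot> x) \<cdot> (y \<odot> z)"

locale regular_q_cycle_set = q_cycle_set +
  assumes colon_bij: "x \<in> carrier X \<Longrightarrow> bij_betw (\<lambda>y. x \<odot> y) (carrier X) (carrier X)"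

text \<open>Elements of \<open>BijGroup\<close> are extensional, hence the restrictions.\<close>

definition q_sigma :: "('a, 'm) q_cycle_scheme \<Rightarrow> 'a \<Rightarrow> 'a \<Rightarrow> 'a" where
  "q_sigma X x = (\<lambda>y\<in>carrier X. x \<cdot>\<^bsub>X\<^esub> y)"

definition q_delta :: "('a, 'm) q_cycle_scheme \<Rightarrow> 'a \<Rightarrow> 'a \<Rightarrow> 'a" where
  "q_delta X x = (\<lambda>y\<in>carrier X. x \<odot>\<^bsub>X\<^esub> y)"

definition q_perm_group :: "('a, 'm) q_cycle_scheme \<Rightarrow> ('a \<Rightarrow> 'a) monoid" where
  "q_perm_group X = subgroup_generated (BijGroup (carrier X))
     (q_sigma X ` carrier X \<union> q_delta X ` carrier X)"

locale indecomposable_q_cycle_set = regular_q_cycle_set +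
  assumes transitive: "transitive_action (q_perm_group X) (carrier X) (\<lambda>g. g)"

definition q_hom :: "('a, 'm) q_cycle_scheme \<Rightarrow> ('b, 'n) q_cycle_scheme \<Rightarrow> ('a \<Rightarrow> 'b) set" where
  "q_hom X Y = {f \<in> carrier X \<rightarrow> carrier Y. \<forall>x\<in>carrier X. \<forall>y\<in>carrier X.
     f (x \<cdot>\<^bsub>X\<^esub> y) = f x \<cdot>\<^bsub>Y\<^esub> f y \<and> f (x \<odot>\<^bsub>X\<^esub> y) = f x \<odot>\<^bsub>Y\<^esub> f y}"

definition q_epi :: "('a, 'm) q_cycle_scheme \<Rightarrow> ('b, 'n) q_cycle_scheme \<Rightarrow> ('a \<Rightarrow> 'b) set" where
  "q_epi X Y = {f \<in> q_hom X Y. f ` carrier X = carrier Y}"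

definition q_iso :: "('a, 'm) q_cycle_scheme \<Rightarrow> ('b, 'n) q_cycle_scheme \<Rightarrow> ('a \<Rightarrow> 'b) set" where
  "q_iso X Y = {f \<in> q_hom X Y. bij_betw f (carrier X) (carrier Y)}"

definition q_isomorphic :: "('a, 'm) q_cycle_scheme \<Rightarrow> ('b, 'n) q_cycle_scheme \<Rightarrow> bool"
    (infix "\<cong>\<^sub>q" 60) where
  "X \<cong>\<^sub>q Y \<longleftrightarrow> q_iso X Y \<noteq> {}"

text \<open>\<open>\<alpha> x y s t\<close> stands for the value at \<open>t\<close> of the map \<open>\<alpha>(x, y, s)\<close>, and likewise for \<open>\<alpha>'\<close>.\<close>

locale dynamical_pair =
  fixes Y :: "('b, 'm) q_cycle_scheme" (structure)
    and S :: "'s set"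
    and \<alpha> \<alpha>' :: "'b \<Rightarrow> 'b \<Rightarrow> 's \<Rightarrow> 's \<Rightarrow> 's"
  assumes alpha_bij: "\<lbrakk>x \<in> carrier Y; y \<in> carrier Y; s \<in> S\<rbrakk> \<Longrightarrow> bij_betw (\<alpha> x y s) S S"
    and alpha'_maps: "\<lbrakk>x \<in> carrier Y; y \<in> carrier Y; s \<in> S\<rbrakk> \<Longrightarrow> \<alpha>' x y s \<in> S \<rightarrow> S"
    and dyn1: "\<lbrakk>x \<in> carrier Y; y \<in> carrier Y; z \<in> carrier Y; s \<in> S; t \<in> S; u \<in> S\<rbrakk>
      \<Longrightarrow> \<alpha> (x \<cdot> y) (x \<cdot> z) (\<alpha> x y s t) (\<alpha> x z s u)
        = \<alpha> (y \<odot> x) (y \<cdot> z) (\<alpha>' y x t s) (\<alpha> y z t u)"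
    and dyn2: "\<lbrakk>x \<in> carrier Y; y \<in> carrier Y; z \<in> carrier Y; s \<in> S; t \<in> S; u \<in> S\<rbrakk>
      \<Longrightarrow> \<alpha>' (x \<odot> y) (x \<odot> z) (\<alpha>' x y s t) (\<alpha>' x z s u)
        = \<alpha>' (y \<cdot> x) (y \<odot> z) (\<alpha> y x t s) (\<alpha>' y z t u)"
    and dyn3: "\<lbrakk>x \<in> carrier Y; y \<in> carrier Y; z \<in> carrier Y; s \<in> S; t \<in> S; u \<in> S\<rbrakk>
      \<Longrightarrow> \<alpha>' (x \<cdot> y) (x \<cdot> z) (\<alpha> x y s t) (\<alpha> x z s u)
        = \<alpha> (y \<odot> x) (y \<odot> z) (\<alpha>' y x t s) (\<alpha>' y z t u)"

definition dynamical_extension ::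
    "('b, 'm) q_cycle_scheme \<Rightarrow> 's set \<Rightarrow> ('b \<Rightarrow> 'b \<Rightarrow> 's \<Rightarrow> 's \<Rightarrow> 's)
      \<Rightarrow> ('b \<Rightarrow> 'b \<Rightarrow> 's \<Rightarrow> 's \<Rightarrow> 's) \<Rightarrow> ('b \<times> 's) q_cycle" where
  "dynamical_extension Y S \<alpha> \<alpha>' =
     \<lparr>carrier = carrier Y \<times> S,
      qdot = (\<lambda>(x, s) (y, t). (x \<cdot>\<^bsub>Y\<^esub> y, \<alpha> x y s t)),
      qcolon = (\<lambda>(x, s) (y, t). (x \<odot>\<^bsub>Y\<^esub> y, \<alpha>' x y s t))\<rparr>"

lemma (in regular_q_cycle_set) q_perm_group_action:
  "group_action (q_perm_group X) (carrier X) (\<lambda>g. g)"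
proof -
  interpret B: group "BijGroup (carrier X)" by (rule group_BijGroup)
  have "group (q_perm_group X)"
    unfolding q_perm_group_def by (rule B.group_subgroup_generated)
  moreover have "(\<lambda>g. g) \<in> hom (q_perm_group X) (BijGroup (carrier X))"
    unfolding q_perm_group_def hom_def
    using B.carrier_subgroup_generated_subset by auto
  ultimately show ?thesis
    by (simp add: group_action_def group_hom_def group_hom_axioms_def B.is_group)
qed

lemma q_sigma_in_q_perm_group:
  "q_cycle_set X \<Longrightarrow> x \<in> carrier X \<Longrightarrow> q_sigma X x \<in> carrier (q_perm_group X)"
  by (auto simp: q_perm_group_def carrier_subgroup_generated BijGroup_def Bij_def q_sigma_def
      q_cycle_set.dot_bij intro!: generate.incl)

lemma q_delta_in_q_perm_group:
  "regular_q_cycle_set X \<Longrightarrow> x \<in> carrier X \<Longrightarrow> q_delta X x \<in> carrier (q_perm_group X)"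
  by (auto simp: q_perm_group_def carrier_subgroup_generated BijGroup_def Bij_def q_delta_def
      regular_q_cycle_set.colon_bij intro!: generate.incl)

lemma q_cycle_set_dynamical_extension:
  assumes "q_cycle_set Y" "dynamical_pair Y S \<alpha> \<alpha>'" "S \<noteq> {}"
  shows "q_cycle_set (dynamical_extension Y S \<alpha> \<alpha>')"
proof -
  interpret Y: q_cycle_set Y by fact
  interpret D: dynamical_pair Y S \<alpha> \<alpha>' by fact
  have bij: "bij_betw (\<lambda>(y, t). (x \<cdot>\<^bsub>Y\<^esub> y, \<alpha> x y s t)) (carrier Y \<times> S) (carrier Y \<times> S)"
    if x: "x \<in> carrier Y" "s \<in> S" for x s
  proof (rule bij_betw_imageI)
    show "inj_on (\<lambda>(y, t). (x \<cdot>\<^bsub>Y\<^esub> y, \<alpha> x y s t)) (carrier Y \<times> S)"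
    proof (rule inj_onI, clarsimp)
      fix y t y' t'
      assume a: "y \<in> carrier Y" "t \<in> S" "y' \<in> carrier Y" "t' \<in> S"
        "x \<cdot>\<^bsub>Y\<^esub> y = x \<cdot>\<^bsub>Y\<^esub> y'" "\<alpha> x y s t = \<alpha> x y' s t'"
      have "y = y'" using Y.dot_bij[OF x(1)] a by (auto simp: bij_betw_def inj_on_def)
      moreover from this have "t = t'"
        using D.alpha_bij[OF x(1) a(1) x(2)] a by (auto simp: bij_betw_def inj_on_def)
      ultimately show "y = y' \<and> t = t'" ..
    qed
    show "(\<lambda>(y, t). (x \<cdot>\<^bsub>Y\<^esub> y, \<alpha> x y s t)) ` (carrier Y \<times> S) = carrier Y \<times> S"
    proof
      show "(\<lambda>(y, t). (x \<cdot>\<^bsub>Y\<^esub> y, \<alpha> x y s t)) ` (carrier Y \<times> S) \<subseteq> carrier Y \<times> S"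
        using Y.dot_bij[OF x(1)] D.alpha_bij[OF x(1) _ x(2)] by (auto dest: bij_betwE)
      show "carrier Y \<times> S \<subseteq> (\<lambda>(y, t). (x \<cdot>\<^bsub>Y\<^esub> y, \<alpha> x y s t)) ` (carrier Y \<times> S)"
      proof clarify
        fix z u assume zu: "z \<in> carrier Y" "u \<in> S"
        obtain y where y: "y \<in> carrier Y" "z = x \<cdot>\<^bsub>Y\<^esub> y"
          using Y.dot_bij[OF x(1)] zu(1) by (auto simp: bij_betw_def)
        obtain t where t: "t \<in> S" "u = \<alpha> x y s t"
          using D.alpha_bij[OF x(1) y(1) x(2)] zu(2) by (auto simp: bij_betw_def)
        show "(z, u) \<in> (\<lambda>(y, t). (x \<cdot>\<^bsub>Y\<^esub> y, \<alpha> x y s t)) ` (carrier Y \<times> S)"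
          using y t by force
      qed
    qed
  qed
  show ?thesis
  proof (unfold_locales, unfold dynamical_extension_def, simp_all add: split_beta)
    show "carrier Y \<noteq> {} \<and> S \<noteq> {}"
      using Y.nonempty assms(3) by simp
  qed (use bij[unfolded split_beta] D.alpha'_maps Y.colon_closed Y.q1 Y.q2 Y.q3 D.dyn1 D.dyn2 D.dyn3
       in \<open>auto simp: split_beta Pi_iff\<close>)
qed

end

theory Submission
  imports Defs
begin

text \<open>
  A dynamical extension of \<open>Y\<close> by \<open>S\<close> is a q-cycle set fibred over \<open>Y\<close> in which every fibre has been
  identified with \<open>S\<close>. So an epimorphism \<open>p\<close> presents \<open>X\<close> as a dynamical extension as soon as all
  its fibres have the same size: bijections \<open>e y\<close> from the fibre over \<open>y\<close> onto \<open>S\<close> transport the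
  operations of \<open>X\<close> to maps \<open>\<alpha>\<close>, \<open>\<alpha>'\<close>, the three axioms of a q-cycle set become the three
  conditions on a dynamical pair, and \<open>x \<mapsto> (p x, e (p x) x)\<close> is an isomorphism
  (\<open>dynamical_pair_transport\<close>, \<open>q_iso_transport\<close>). The maps \<open>\<alpha> x y s\<close> are bijective because a left
  multiplication of \<open>X\<close> lies over an injective left multiplication of \<open>Y\<close> and hence maps each fibre
  onto a fibre.

  Indecomposability gives the equality of sizes. Each generator of the permutation group
  of \<open>X\<close> is a bijection lying over a self-map of \<open>Y\<close>, which is surjective because \<open>p\<close> is, and
  hence injective because \<open>Y\<close> is finite. So each generator maps fibres bijectively onto fibres, and
  all elements of the group preserve the size of the fibre through a point (\<open>card_fibre_generate\<close>).
  As the group is transitive, this size is constant.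
\<close>

definition fibre :: "('a, 'm) q_cycle_scheme \<Rightarrow> ('a \<Rightarrow> 'b) \<Rightarrow> 'b \<Rightarrow> 'a set" where
  "fibre X p y = {x \<in> carrier X. p x = y}"

text \<open>Injectivity of the map downstairs is what makes the image of a fibre exhaust the fibre in
  which it lies.\<close>

lemma bij_betw_fibres:
  assumes f: "bij_betw f (carrier X) (carrier X)"
    and pf: "\<And>x. x \<in> carrier X \<Longrightarrow> p (f x) = g (p x)"
    and p: "p ` carrier X = B"
    and g: "inj_on g B"
    and y: "y \<in> B"
  shows "bij_betw f (fibre X p y) (fibre X p (g y))"
proof (rule bij_betw_imageI)
  show "inj_on f (fibre X p y)"
    using f by (auto simp: bij_betw_def fibre_def intro: inj_on_subset)
  show "f ` fibre X p y = fibre X p (g y)"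
  proof
    show "f ` fibre X p y \<subseteq> fibre X p (g y)"
      using f pf by (auto simp: fibre_def dest: bij_betwE)
    show "fibre X p (g y) \<subseteq> f ` fibre X p y"
    proof
      fix w assume w: "w \<in> fibre X p (g y)"
      then obtain z where z: "z \<in> carrier X" "w = f z"
        using f by (auto simp: fibre_def bij_betw_def)
      then have "g (p z) = g y" using w pf by (simp add: fibre_def)
      then have "p z = y" using g y p z(1) by (auto dest: inj_onD)
      then show "w \<in> f ` fibre X p y" using z by (simp add: fibre_def)
    qed
  qed
qed

text \<open>The map \<open>g\<close> permutes the image of \<open>p\<close>: it is onto because \<open>f\<close> is, and the image is finite.
  This is how the maps \<open>\<delta>\<close>, which are bijective on \<open>X\<close> by regularity, are seen to be bijective
  on \<open>Y\<close>.\<close>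

lemma card_fibre_invariant:
  assumes fin: "finite (carrier X)"
    and f: "bij_betw f (carrier X) (carrier X)"
    and pf: "\<And>x. x \<in> carrier X \<Longrightarrow> p (f x) = g (p x)"
    and x: "x \<in> carrier X"
  shows "card (fibre X p (p (f x))) = card (fibre X p (p x))"
proof -
  let ?B = "p ` carrier X"
  have "g ` ?B = p ` f ` carrier X"
    using pf by (auto simp: image_image)
  also have "\<dots> = ?B" using f by (simp add: bij_betw_def)
  finally have "inj_on g ?B" using fin by (simp add: eq_card_imp_inj_on)
  then have "bij_betw f (fibre X p (p x)) (fibre X p (g (p x)))"
    using x by (intro bij_betw_fibres[OF f, where p = p and B = ?B] pf refl) auto
  then show ?thesis using pf[OF x] by (simp add: bij_betw_same_card)
qed

text \<open>Invariance passes from \<open>h\<close> to its inverse \<open>k\<close> because \<open>c (k x) = c (h (k x)) = c x\<close>. The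
  quantity \<open>c\<close> of interest is the size of the fibre through a point.\<close>

lemma generate_BijGroup_invariant:
  assumes g: "g \<in> generate (BijGroup E) H"
    and H: "H \<subseteq> Bij E"
    and inv: "\<And>h x. h \<in> H \<Longrightarrow> x \<in> E \<Longrightarrow> c (h x) = c x"
    and x: "x \<in> E"
  shows "c (g x) = c x"
  using g x
proof (induction arbitrary: x rule: generate.induct)
  case one
  then show ?case by (simp add: BijGroup_def)
next
  case (incl h)
  then show ?case by (rule inv)
next
  case (inv h)
  then have h: "h \<in> Bij E" using H by blast
  let ?k = "inv_into E h"
  have "h ` E = E" using h by (simp add: Bij_def bij_betw_def)
  then have "?k x \<in> E" "h (?k x) = x"
    using inv(2) by (auto intro: inv_into_into f_inv_into_f)
  then have "c (?k x) = c x" using assms(3)[OF inv(1), of "?k x"] by simp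
  then show ?case using inv(2) by (simp add: inv_BijGroup[OF h])
next
  case (eng h1 h2)
  interpret B: group "BijGroup E" by (rule group_BijGroup)
  have "generate (BijGroup E) H \<subseteq> Bij E"
    using B.generate_incl[of H] H by (simp add: BijGroup_def)
  then have h: "h1 \<in> Bij E" "h2 \<in> Bij E" using eng.hyps by auto
  then have "h2 x \<in> E" using eng.prems by (auto simp: Bij_def dest: bij_betwE)
  then show ?case
    using h eng by (simp add: BijGroup_def compose_eq)
qed

lemma card_fibre_generate:
  fixes X :: "('a, 'm) q_cycle_scheme" and Y :: "('b, 'n) q_cycle_scheme"
  assumes fin: "finite (carrier X)" and "regular_q_cycle_set X" and p: "p \<in> q_hom X Y"
    and g: "g \<in> carrier (q_perm_group X)" and x: "x \<in> carrier X"
  shows "card (fibre X p (p (g x))) = card (fibre X p (p x))"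
proof -
  interpret X: regular_q_cycle_set X by fact
  interpret B: group "BijGroup (carrier X)" by (rule group_BijGroup)
  let ?H = "q_sigma X ` carrier X \<union> q_delta X ` carrier X"
  have H: "?H \<subseteq> Bij (carrier X)"
    using X.dot_bij X.colon_bij by (auto simp: Bij_def q_sigma_def q_delta_def)
  then have "g \<in> generate (BijGroup (carrier X)) ?H"
    using g by (simp add: q_perm_group_def carrier_subgroup_generated BijGroup_def Int_absorb1)
  moreover have "card (fibre X p (p (h z))) = card (fibre X p (p z))"
    if h: "h \<in> ?H" and z: "z \<in> carrier X" for h z
  proof -
    have "\<exists>k. \<forall>w\<in>carrier X. p (h w) = k (p w)"
    proof -
      obtain x where x: "x \<in> carrier X" "h = q_sigma X x \<or> h = q_delta X x" using h by blast
      from x(2) show ?thesis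
      proof
        assume "h = q_sigma X x"
        then have "\<forall>w\<in>carrier X. p (h w) = p x \<cdot>\<^bsub>Y\<^esub> p w"
          using p x(1) by (simp add: q_hom_def q_sigma_def)
        then show ?thesis by (rule exI[where x = "\<lambda>y. p x \<cdot>\<^bsub>Y\<^esub> y"])
      next
        assume "h = q_delta X x"
        then have "\<forall>w\<in>carrier X. p (h w) = p x \<odot>\<^bsub>Y\<^esub> p w"
          using p x(1) by (simp add: q_hom_def q_delta_def)
        then show ?thesis by (rule exI[where x = "\<lambda>y. p x \<odot>\<^bsub>Y\<^esub> y"])
      qed
    qed
    then obtain k where "\<And>w. w \<in> carrier X \<Longrightarrow> p (h w) = k (p w)" by blast
    moreover have "bij_betw h (carrier X) (carrier X)"
      using h H by (auto simp: Bij_def)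
    ultimately show ?thesis using card_fibre_invariant[OF fin _ _ z] by blast
  qed
  ultimately show ?thesis
    by (rule generate_BijGroup_invariant[where c = "\<lambda>z. card (fibre X p (p z))", OF _ H _ x])
qed

text \<open>An epimorphism together with a trivialisation \<open>e\<close>, that is, an identification of each fibre
  with a fixed set. This is exactly the datum that a dynamical extension carries on its projection
  to \<open>Y\<close>.\<close>

locale trivialised_epi =
  X: q_cycle_set X + Y: q_cycle_set Y
  for X :: "('a, 'm) q_cycle_scheme" and Y :: "('b, 'n) q_cycle_scheme" +
  fixes p :: "'a \<Rightarrow> 'b" and S :: "'s set" and e :: "'b \<Rightarrow> 'a \<Rightarrow> 's"
  assumes epi: "p \<in> q_epi X Y"
    and e_bij: "y \<in> carrier Y \<Longrightarrow> bij_betw (e y) (fibre X p y) S"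
begin

definition point :: "'b \<Rightarrow> 's \<Rightarrow> 'a" where
  "point y = inv_into (fibre X p y) (e y)"

definition transport_dot :: "'b \<Rightarrow> 'b \<Rightarrow> 's \<Rightarrow> 's \<Rightarrow> 's" where
  "transport_dot x y s t = e (x \<cdot>\<^bsub>Y\<^esub> y) (point x s \<cdot>\<^bsub>X\<^esub> point y t)"

definition transport_colon :: "'b \<Rightarrow> 'b \<Rightarrow> 's \<Rightarrow> 's \<Rightarrow> 's" where
  "transport_colon x y s t = e (x \<odot>\<^bsub>Y\<^esub> y) (point x s \<odot>\<^bsub>X\<^esub> point y t)"

lemma point_bij: "y \<in> carrier Y \<Longrightarrow> bij_betw (point y) S (fibre X p y)"
  unfolding point_def by (intro bij_betw_inv_into e_bij)

lemma point_mem: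
  assumes "y \<in> carrier Y" "s \<in> S"
  shows "point y s \<in> carrier X" "p (point y s) = y"
  using bij_betwE[OF point_bij] assms by (auto simp: fibre_def)

lemma point_e: "y \<in> carrier Y \<Longrightarrow> x \<in> carrier X \<Longrightarrow> p x = y \<Longrightarrow> point y (e y x) = x"
  unfolding point_def by (rule bij_betw_inv_into_left[OF e_bij]) (auto simp: fibre_def)

lemma e_point: "y \<in> carrier Y \<Longrightarrow> s \<in> S \<Longrightarrow> e y (point y s) = s"
  using bij_betw_inv_into_right[OF e_bij] by (simp add: point_def)

lemma e_mem: "y \<in> carrier Y \<Longrightarrow> x \<in> carrier X \<Longrightarrow> p x = y \<Longrightarrow> e y x \<in> S"
  using bij_betwE[OF e_bij] by (simp add: fibre_def)

lemma p_image: "p ` carrier X = carrier Y"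
  using epi by (simp add: q_epi_def)

lemma p_mem: "x \<in> carrier X \<Longrightarrow> p x \<in> carrier Y"
  using p_image by blast

lemma p_dot: "x \<in> carrier X \<Longrightarrow> y \<in> carrier X \<Longrightarrow> p (x \<cdot>\<^bsub>X\<^esub> y) = p x \<cdot>\<^bsub>Y\<^esub> p y"
  and p_colon: "x \<in> carrier X \<Longrightarrow> y \<in> carrier X \<Longrightarrow> p (x \<odot>\<^bsub>X\<^esub> y) = p x \<odot>\<^bsub>Y\<^esub> p y"
  using epi by (auto simp: q_epi_def q_hom_def)

lemma X_dot_closed: "x \<in> carrier X \<Longrightarrow> y \<in> carrier X \<Longrightarrow> x \<cdot>\<^bsub>X\<^esub> y \<in> carrier X"
  using X.dot_bij by (auto dest: bij_betwE)

lemma Y_dot_closed: "x \<in> carrier Y \<Longrightarrow> y \<in> carrier Y \<Longrightarrow> x \<cdot>\<^bsub>Y\<^esub> y \<in> carrier Y"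
  using Y.dot_bij by (auto dest: bij_betwE)

lemmas closed = X_dot_closed Y_dot_closed X.colon_closed Y.colon_closed

lemma point_transport:
  assumes "x \<in> carrier Y" "y \<in> carrier Y" "s \<in> S" "t \<in> S"
  shows "point (x \<cdot>\<^bsub>Y\<^esub> y) (transport_dot x y s t) = point x s \<cdot>\<^bsub>X\<^esub> point y t"
    and "point (x \<odot>\<^bsub>Y\<^esub> y) (transport_colon x y s t) = point x s \<odot>\<^bsub>X\<^esub> point y t"
  using assms by (simp_all add: transport_dot_def transport_colon_def point_e point_mem
      p_dot p_colon closed)

text \<open>Up to the identification \<open>e\<close> of fibres, \<open>transport_dot x y s\<close> is left multiplication by the
  point \<open>point x s\<close> of the fibre over \<open>x\<close>, restricted to the fibre over \<open>y\<close>.\<close>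

lemma bij_transport_dot:
  assumes x: "x \<in> carrier Y" and y: "y \<in> carrier Y" and s: "s \<in> S"
  shows "bij_betw (transport_dot x y s) S S"
proof -
  let ?a = "point x s"
  have "bij_betw (\<lambda>z. ?a \<cdot>\<^bsub>X\<^esub> z) (fibre X p y) (fibre X p (x \<cdot>\<^bsub>Y\<^esub> y))"
  proof (rule bij_betw_fibres[where g = "\<lambda>z. x \<cdot>\<^bsub>Y\<^esub> z", OF _ _ p_image _ y])
    show "bij_betw (\<lambda>z. ?a \<cdot>\<^bsub>X\<^esub> z) (carrier X) (carrier X)"
      using x s by (intro X.dot_bij point_mem)
    show "inj_on (\<lambda>z. x \<cdot>\<^bsub>Y\<^esub> z) (carrier Y)"
      using Y.dot_bij[OF x] by (rule bij_betw_imp_inj_on)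
  qed (use x s in \<open>simp add: p_dot point_mem\<close>)
  from bij_betw_trans[OF bij_betw_trans[OF point_bij[OF y] this] e_bij[OF Y_dot_closed[OF x y]]]
  show ?thesis by (simp add: transport_dot_def[abs_def] comp_def)
qed

text \<open>Each dynamical condition is, after applying \<open>e\<close>, one q-cycle axiom of \<open>X\<close>
  at the points \<open>point x s\<close>, \<open>point y t\<close> and \<open>point z u\<close>; the same axiom of \<open>Y\<close> ensures that both sides
  lie in the same fibre.\<close>

lemma dynamical_pair_transport: "dynamical_pair Y S transport_dot transport_colon"
proof
  fix x y s assume "x \<in> carrier Y" "y \<in> carrier Y" "s \<in> S"
  then show "bij_betw (transport_dot x y s) S S" by (rule bij_transport_dot)
next
  fix x y s assume "x \<in> carrier Y" "y \<in> carrier Y" "s \<in> S"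
  then show "transport_colon x y s \<in> S \<rightarrow> S"
    by (auto simp: transport_colon_def point_mem p_colon closed intro!: e_mem)
next
  fix x y z s t u
  assume "x \<in> carrier Y" "y \<in> carrier Y" "z \<in> carrier Y" "s \<in> S" "t \<in> S" "u \<in> S"
  note a = this
  show "transport_dot (x \<cdot>\<^bsub>Y\<^esub> y) (x \<cdot>\<^bsub>Y\<^esub> z) (transport_dot x y s t) (transport_dot x z s u)
      = transport_dot (y \<odot>\<^bsub>Y\<^esub> x) (y \<cdot>\<^bsub>Y\<^esub> z) (transport_colon y x t s) (transport_dot y z t u)"
    using a by (simp add: transport_dot_def[of "_ \<cdot>\<^bsub>Y\<^esub> _"] transport_dot_def[of "_ \<odot>\<^bsub>Y\<^esub> _"]
        point_transport Y.q1 X.q1 point_mem)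
  show "transport_colon (x \<odot>\<^bsub>Y\<^esub> y) (x \<odot>\<^bsub>Y\<^esub> z) (transport_colon x y s t) (transport_colon x z s u)
      = transport_colon (y \<cdot>\<^bsub>Y\<^esub> x) (y \<odot>\<^bsub>Y\<^esub> z) (transport_dot y x t s) (transport_colon y z t u)"
    using a by (simp add: transport_colon_def[of "_ \<cdot>\<^bsub>Y\<^esub> _"] transport_colon_def[of "_ \<odot>\<^bsub>Y\<^esub> _"]
        point_transport Y.q2 X.q2 point_mem)
  show "transport_colon (x \<cdot>\<^bsub>Y\<^esub> y) (x \<cdot>\<^bsub>Y\<^esub> z) (transport_dot x y s t) (transport_dot x z s u)
      = transport_dot (y \<odot>\<^bsub>Y\<^esub> x) (y \<odot>\<^bsub>Y\<^esub> z) (transport_colon y x t s) (transport_colon y z t u)"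
    using a by (simp add: transport_colon_def[of "_ \<cdot>\<^bsub>Y\<^esub> _"] transport_dot_def[of "_ \<odot>\<^bsub>Y\<^esub> _"]
        point_transport Y.q3 X.q3 point_mem)
qed

lemma q_iso_transport:
  "(\<lambda>x. (p x, e (p x) x)) \<in> q_iso X (dynamical_extension Y S transport_dot transport_colon)"
proof -
  have "bij_betw (\<lambda>x. (p x, e (p x) x)) (carrier X) (carrier Y \<times> S)"
    by (rule bij_betw_byWitness[where f' = "\<lambda>(y, s). point y s"])
      (auto simp: p_mem point_e e_point point_mem e_mem)
  then show ?thesis
    by (auto simp: q_iso_def q_hom_def dynamical_extension_def transport_dot_def
        transport_colon_def p_dot p_colon p_mem e_mem point_e)
qed

end

theorem theorem2p3:
  fixes X :: "('a, 'm) q_cycle_scheme" and Y :: "('b, 'n) q_cycle_scheme" and p :: "'a \<Rightarrow> 'b"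
  assumes "finite (carrier X)"
    and "indecomposable_q_cycle_set X"
    and "q_cycle_set Y"
    and "p \<in> q_epi X Y"
  shows "\<exists>(S :: 'a set) \<alpha> \<alpha>'. dynamical_pair Y S \<alpha> \<alpha>' \<and> X \<cong>\<^sub>q dynamical_extension Y S \<alpha> \<alpha>'"
proof -
  interpret X: indecomposable_q_cycle_set X by fact
  interpret T: transitive_action "q_perm_group X" "carrier X" "\<lambda>g. g" by (rule X.transitive)
  have p: "p \<in> q_hom X Y" "p ` carrier X = carrier Y"
    using assms(4) by (auto simp: q_epi_def)
  obtain x0 where x0: "x0 \<in> carrier X" using X.nonempty by blast
  define S where "S = fibre X p (p x0)"
  have fin: "finite (fibre X p y)" for y
    using assms(1) by (simp add: fibre_def)
  have "\<exists>f. bij_betw f (fibre X p y) S" if "y \<in> carrier Y" for y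
  proof -
    obtain x where x: "x \<in> carrier X" "y = p x" using \<open>y \<in> carrier Y\<close> p(2) by blast
    obtain g where "g \<in> carrier (q_perm_group X)" "g x0 = x"
      using T.unique_orbit[OF x0 x(1)] by blast
    then have "card (fibre X p y) = card S"
      using card_fibre_generate[OF assms(1) X.regular_q_cycle_set_axioms p(1) _ x0] x(2)
      by (auto simp: S_def)
    then show ?thesis
      using fin unfolding S_def by (intro finite_same_card_bij)
  qed
  then obtain e where "\<And>y. y \<in> carrier Y \<Longrightarrow> bij_betw (e y) (fibre X p y) S"
    by metis
  then interpret trivialised_epi X Y p S e
    using assms(3,4) X.q_cycle_set_axioms
    by (simp add: trivialised_epi_def trivialised_epi_axioms_def)
  show ?thesis
    using dynamical_pair_transport q_iso_transport by (auto simp: q_isomorphic_def)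
qed

end
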